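(* There is an absolute constant $A>0$ such that for every set $P$ of $m$ distinct points in the plane $\mathbb{R}^2$ and every set $L$ of $n$ distinct lines in $\mathbb{R}^2$ (with $m,n$ positive integers), $$I(P,L)\le A\left(m^{2/3}n^{2/3}+m+n\right).$$
   Context: For a finite set $P\subset\mathbb{R}^2$ and a finite set $L$ of lines in $\mathbb{R}^2$, $I(P,L)$ denotes the number of incidences of $P$ and $L$, i.e., the number of pairs $(p,\ell)$ with $p\in P$, $\ell\in L$, and $p\in\ell$. *)

theory Defs
  imports "HOL-Analysis.Analysis"
begin

definition is_line :: "(real ^ 2) set \<Rightarrow> bool" where
  "is_line l \<longleftrightarrow> affine l \<and> aff_dim l = 1"

definition incidences :: "(real ^ 2) set \<Rightarrow> (real ^ 2) set set \<Rightarrow> nat" where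
  "incidences P L = card {(p, l). p \<in> P \<and> l \<in> L \<and> p \<in> l}"

end

theory Submission
  imports Defs
begin

text \<open>
  This is Szekely's proof of the Szemeredi--Trotter theorem. Cut every line at the points that it
  carries: consecutive points on a line bound a segment (\<open>gaps\<close>), and a line with \<open>k\<close> points gives
  \<open>k - 1\<close> segments, so up to one per line the incidences are counted by the segments
  (\<open>card_graph_incidences_le\<close>). The segments draw a graph on the points. Two lines meet at most
  once, hence at most \<open>n\<^sup>2\<close> ordered pairs of segments cross (\<open>card_crossing_gaps_le\<close>). On the other
  hand a graph with many more edges than vertices must have many crossings, and comparing the two
  counts bounds the number of segments.

  The lower bound on crossings has two steps. A straight-line drawing without crossings has at most
  \<open>3\<close> times as many edges as vertices (\<open>crossing_free_card_le\<close>); deleting one edge from each crossing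
  pair gives \<open>e \<le> 3 v + x\<close> for \<open>e\<close> edges, \<open>v\<close> vertices and \<open>x\<close> crossing pairs. Apply this to the part
  of the drawing on a random set of vertices, each chosen with probability \<open>p\<close>: the expected numbers
  of vertices, edges and crossing pairs are \<open>p v\<close>, \<open>p\<^sup>2 e\<close> and \<open>p\<^sup>4 x\<close>, since the edges of a crossing
  pair have four different end points. Choosing \<open>p = 4 v / e\<close>
  yields \<open>e\<^sup>3 \<le> 64 v\<^sup>2 x\<close> as soon as \<open>e \<ge> 4 v\<close> (\<open>amplification\<close>). With \<open>v = m\<close> and \<open>x \<le> n\<^sup>2\<close> this is
  \<open>e \<le> 4 (m n)\<^bsup>2/3\<^esup>\<close>; otherwise \<open>e < 4 m\<close>.

  The linear bound for crossing-free drawings is proved without Euler's formula, by charging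
  every edge to a vertex in one of three ways (\<open>charging\<close>). This uses the order of the plane from
  left to right, so every line is taken to be the graph of a function \<open>x \<mapsto> a x + b\<close>, given by the
  pair \<open>(a, b)\<close>. Vertical lines cost only one incidence per point, as each point lies on only one
  of them.
\<close>
section \<open>Non-crossing segments\<close>

definition height :: "real \<times> real \<Rightarrow> real \<Rightarrow> real" where
  "height k x = fst k * x + snd k"

text \<open>
  The segment \<open>((a, b), l, r)\<close> is the part of the line \<open>y = a x + b\<close> over the interval from \<open>l\<close> to \<open>r\<close>.
  Keeping the line makes the height over any abscissa an affine expression.
\<close>
type_synonym segment = "(real \<times> real) \<times> real \<times> real"

abbreviation line_of :: "segment \<Rightarrow> real \<times> real" where "line_of e \<equiv> fst e"
abbreviation slope :: "segment \<Rightarrow> real" where "slope e \<equiv> fst (fst e)"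
abbreviation lo :: "segment \<Rightarrow> real" where "lo e \<equiv> fst (snd e)"
abbreviation hi :: "segment \<Rightarrow> real" where "hi e \<equiv> snd (snd e)"

definition ordinate :: "segment \<Rightarrow> real \<Rightarrow> real" where "ordinate e x = height (line_of e) x"
definition left_end :: "segment \<Rightarrow> real \<times> real" where "left_end e = (lo e, ordinate e (lo e))"
definition right_end :: "segment \<Rightarrow> real \<times> real" where "right_end e = (hi e, ordinate e (hi e))"

text \<open>
  Only common interior points count, so segments that share an end point need not cross;
  segments that overlap do.
\<close>
definition crosses :: "segment \<Rightarrow> segment \<Rightarrow> bool" where
  "crosses e f \<longleftrightarrow> (\<exists>x. lo e < x \<and> x < hi e \<and> lo f < x \<and> x < hi f \<and> ordinate e x = ordinate f x)"

definition drawn_on :: "(real \<times> real) set \<Rightarrow> segment set \<Rightarrow> bool" where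
  "drawn_on V E \<longleftrightarrow> finite V \<and> finite E \<and>
     (\<forall>e\<in>E. lo e < hi e \<and> left_end e \<in> V \<and> right_end e \<in> V \<and>
        (\<forall>v\<in>V. lo e < fst v \<and> fst v < hi e \<longrightarrow> snd v \<noteq> ordinate e (fst v)))"

definition crossing_free :: "segment set \<Rightarrow> bool" where
  "crossing_free E \<longleftrightarrow> (\<forall>e\<in>E. \<forall>f\<in>E. e \<noteq> f \<longrightarrow> \<not> crosses e f)"

lemma finite_minimizer:
  fixes f :: "'a \<Rightarrow> real"
  assumes "finite S" "S \<noteq> {}"
  obtains m where "m \<in> S" "\<And>x. x \<in> S \<Longrightarrow> f m \<le> f x"
  using ex_is_arg_min_if_finite[OF assms, of f] by (auto simp: is_arg_min_def not_less)

lemma ordinate_diff: "ordinate e y - ordinate e x = slope e * (y - x)"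
  by (simp add: ordinate_def height_def algebra_simps)

lemma ordinate_intermediate:
  assumes "ordinate f x < ordinate e x" "ordinate e y < ordinate f y"
  obtains z where "min x y < z" "z < max x y" "ordinate e z = ordinate f z"
proof -
  define d where "d z = ordinate e z - ordinate f z" for z
  have cont: "continuous_on S d" for S
    unfolding d_def ordinate_def height_def by (intro continuous_intros)
  have ne: "x \<noteq> y" using assms by auto
  have "\<exists>z. min x y \<le> z \<and> z \<le> max x y \<and> d z = 0"
  proof (cases "x < y")
    case True
    then show ?thesis
      using IVT2'[of d y 0 x] assms cont by (auto simp: d_def)
  next
    case False
    then show ?thesis
      using IVT'[of d y 0 x] assms cont by (auto simp: d_def)
  qed
  then obtain z where z: "min x y \<le> z" "z \<le> max x y" "d z = 0" by blast
  have "z \<noteq> x" "z \<noteq> y" using z assms by (auto simp: d_def)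
  then show ?thesis using that[of z] z ne by (auto simp: d_def min_def max_def split: if_splits)
qed

text \<open>
  The topological input of the whole argument: by the intermediate value theorem, segments that do
  not cross keep their vertical order over their common abscissas. Strictness may get lost at an
  end point, where they are allowed to meet.
\<close>
lemma no_swap:
  assumes "crossing_free E" "e \<in> E" "f \<in> E"
    and "lo e \<le> x" "x \<le> hi e" "lo f \<le> x" "x \<le> hi f"
    and "lo e \<le> y" "y \<le> hi e" "lo f \<le> y" "y \<le> hi f"
    and "ordinate f x < ordinate e x"
  shows "ordinate f y \<le> ordinate e y"
proof (rule ccontr)
  assume "\<not> ?thesis"
  then obtain z where z: "min x y < z" "z < max x y" "ordinate e z = ordinate f z"
    using ordinate_intermediate[of f x e y] assms by auto
  have "e \<noteq> f" using assms by auto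
  moreover have "crosses e f"
    unfolding crosses_def using z assms by (intro exI[of _ z]) (auto simp: min_def max_def split: if_splits)
  ultimately show False using assms by (auto simp: crossing_free_def)
qed

text \<open>
  The three ways of charging a segment to a vertex: to its left end if it is the topmost
  segment starting there, to its right end if it is the topmost segment ending there (to the left
  of a vertex the topmost segment is the one of smallest slope), and to a vertex that lies strictly
  above its interior with no other segment in between.
\<close>
definition top_from_left :: "segment set \<Rightarrow> segment \<Rightarrow> bool" where
  "top_from_left E e \<longleftrightarrow> (\<forall>f\<in>E. left_end f = left_end e \<longrightarrow> slope f \<le> slope e)"

definition top_into_right :: "segment set \<Rightarrow> segment \<Rightarrow> bool" where
  "top_into_right E e \<longleftrightarrow> (\<forall>f\<in>E. right_end f = right_end e \<longrightarrow> slope e \<le> slope f)"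

definition first_below :: "segment set \<Rightarrow> real \<times> real \<Rightarrow> segment \<Rightarrow> bool" where
  "first_below E w e \<longleftrightarrow> lo e < fst w \<and> fst w < hi e \<and> ordinate e (fst w) < snd w \<and>
     (\<forall>f\<in>E. lo f < fst w \<and> fst w < hi f \<and> ordinate f (fst w) < snd w \<longrightarrow> ordinate f (fst w) \<le> ordinate e (fst w))"

text \<open>
  Suppose that \<open>e\<close> does not have the largest slope at its left end, and let \<open>g\<close> be the next one above it.
  Look at the vertices in the wedge between \<open>e\<close> and \<open>g\<close>, to the left of the right end of \<open>e\<close>.
  If there are any, then \<open>e\<close> is the first segment below the leftmost of them: a segment \<open>f\<close> in
  between could not leave the wedge towards the left, so its left end would be a vertex of the wedge
  further left, or \<open>f\<close> would emanate from the left end of \<open>e\<close> between \<open>e\<close> and \<open>g\<close>.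
  If there are none, then \<open>g\<close> reaches over the right end of \<open>e\<close>, and a segment arriving there
  from above \<open>e\<close> would have to start inside the wedge or cross \<open>g\<close>.
\<close>
lemma charging:
  assumes dr: "drawn_on V E" and cf: "crossing_free E" and e: "e \<in> E"
  shows "top_from_left E e \<or> top_into_right E e \<or> (\<exists>w\<in>V. first_below E w e)"
proof (rule disjCI)
  assume neg: "\<not> (top_into_right E e \<or> (\<exists>w\<in>V. first_below E w e))"
  have finV: "finite V" and finE: "finite E"
    and lh: "\<And>f. f \<in> E \<Longrightarrow> lo f < hi f"
    and lV: "\<And>f. f \<in> E \<Longrightarrow> (lo f, ordinate f (lo f)) \<in> V"
    and rV: "\<And>f. f \<in> E \<Longrightarrow> (hi f, ordinate f (hi f)) \<in> V"
    using dr by (auto simp: drawn_on_def left_end_def right_end_def)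
  have nov: "y \<noteq> ordinate f x" if "f \<in> E" "(x, y) \<in> V" "lo f < x" "x < hi f" for f x y
    using dr that unfolding drawn_on_def by fastforce
  show "top_from_left E e"
  proof (rule ccontr)
    assume "\<not> top_from_left E e"
    define U where "U = {f \<in> E. left_end f = left_end e \<and> slope e < slope f}"
    obtain f where "f \<in> E" "left_end f = left_end e" "\<not> slope f \<le> slope e"
      using \<open>\<not> top_from_left E e\<close> unfolding top_from_left_def by blast
    then have "f \<in> U" by (simp add: U_def)
    then have "U \<noteq> {}" by blast
    moreover have "finite U" using finE by (simp add: U_def)
    ultimately obtain g where g: "g \<in> U" "\<And>f. f \<in> U \<Longrightarrow> slope g \<le> slope f"
      using finite_minimizer[of U slope] by blast
    have gE: "g \<in> E" and glo: "lo g = lo e" and gat: "ordinate g (lo e) = ordinate e (lo e)"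
      and gs: "slope e < slope g"
      using g(1) by (auto simp: U_def left_end_def)
    have e_below_g: "ordinate e x < ordinate g x" if "lo e < x" for x
    proof -
      have "slope e * (x - lo e) < slope g * (x - lo e)" using gs that by simp
      then show ?thesis using ordinate_diff[of e x "lo e"] ordinate_diff[of g x "lo e"] gat by linarith
    qed
    \<comment> \<open>The vertices in the wedge, including those on its upper side (such as the right end of \<open>g\<close>).\<close>
    define W where "W = {w \<in> V. lo e < fst w \<and> fst w < hi e \<and> fst w \<le> hi g \<and>
        ordinate e (fst w) < snd w \<and> snd w \<le> ordinate g (fst w)}"
    have WI: "(x, y) \<in> W" if "(x, y) \<in> V" "lo e < x" "x < hi e" "x \<le> hi g" "ordinate e x < y" "y \<le> ordinate g x" for x y
      using that by (auto simp: W_def)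
    show False
    proof (cases "W = {}")
      case False
      have "finite W" using finV by (auto simp: W_def)
      then obtain w where w: "w \<in> W" "\<And>v. v \<in> W \<Longrightarrow> fst w \<le> fst v"
        using False finite_minimizer[of W fst] by blast
      obtain x y where xy: "w = (x, y)" by (cases w)
      have wp: "w \<in> V" "lo e < x" "x < hi e" "x \<le> hi g" "ordinate e x < y" "y \<le> ordinate g x"
        using w(1) xy by (auto simp: W_def)
      \<comment> \<open>A segment \<open>f\<close> separating \<open>e\<close> from \<open>w\<close> stays between \<open>e\<close> and \<open>g\<close> to the left of \<open>w\<close>.\<close>
      have "\<not> first_below E w e" using neg wp by blast
      then obtain f where f: "f \<in> E" "lo f < x" "x < hi f" "ordinate f x < y" "ordinate e x < ordinate f x"
        using wp xy by (auto simp: first_below_def)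
      have ef: "ordinate e z \<le> ordinate f z" if "lo e \<le> z" "z \<le> x" "lo f \<le> z" for z
        using no_swap[OF cf f(1) e, of x z] f wp that by simp
      have fg: "ordinate f z \<le> ordinate g z" if "lo e \<le> z" "z \<le> x" "lo f \<le> z" for z
        using no_swap[OF cf gE f(1), of x z] f wp that glo by simp
      show False
      proof (cases "lo e < lo f")
        case True
        have "ordinate f (lo f) \<noteq> ordinate e (lo f)"
          using nov[OF e lV[OF f(1)]] True f wp by simp
        then have "(lo f, ordinate f (lo f)) \<in> W"
          using WI[OF lV[OF f(1)]] True ef[of "lo f"] fg[of "lo f"] f wp by simp
        then show False using w(2) f xy by fastforce
      next
        case False
        \<comment> \<open>Squeezed between \<open>e\<close> and \<open>g\<close> at their common left end, \<open>f\<close> passes through that vertex.\<close>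
        have fe: "ordinate f (lo e) = ordinate e (lo e)"
          using ef[of "lo e"] fg[of "lo e"] False gat wp by simp
        have "\<not> lo f < lo e"
          using nov[OF f(1) lV[OF e]] fe less_trans[OF wp(2) f(3)] by argo
        then have lf: "lo f = lo e" using False by simp
        have sl: "slope e * (x - lo e) < slope f * (x - lo e)" "slope f * (x - lo e) < slope g * (x - lo e)"
          using ordinate_diff[of e x "lo e"] ordinate_diff[of f x "lo e"] ordinate_diff[of g x "lo e"] fe gat f wp
          by linarith+
        then have "slope e < slope f" "slope f < slope g"
          using wp by (auto simp: mult_less_cancel_right)
        moreover have "left_end f = left_end e" using lf fe by (simp add: left_end_def)
        ultimately show False using g(2)[of f] f(1) by (auto simp: U_def)
      qed
    next
      case True
      \<comment> \<open>Otherwise the right end of \<open>g\<close> would be a vertex of the wedge.\<close>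
      have hg: "hi e \<le> hi g"
      proof (rule ccontr)
        assume "\<not> ?thesis"
        then have "(hi g, ordinate g (hi g)) \<in> W"
          using WI[OF rV[OF gE]] lh[OF gE] glo e_below_g by simp
        then show False using True by simp
      qed
      have "\<not> top_into_right E e" using neg by blast
      then obtain f where f: "f \<in> E" "hi f = hi e" "ordinate f (hi e) = ordinate e (hi e)" "slope f < slope e"
        by (auto simp: top_into_right_def right_end_def)
      have e_below_f: "ordinate e x < ordinate f x" if "x < hi e" for x
      proof -
        have "slope f * (hi e - x) < slope e * (hi e - x)" using f that by simp
        then show ?thesis using ordinate_diff[of e "hi e" x] ordinate_diff[of f "hi e" x] f by linarith
      qed
      have fg: "ordinate f z \<le> ordinate g z" if "lo e \<le> z" "z \<le> hi e" "lo f \<le> z" for z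
        using no_swap[OF cf gE f(1), of "hi e" z] f hg that glo lh[OF e] lh[OF f(1)]
          e_below_g[of "hi e"] by simp
      show False
      proof (cases "lo e < lo f")
        case True
        then have "(lo f, ordinate f (lo f)) \<in> W"
          using WI[OF lV[OF f(1)]] fg[of "lo f"] e_below_f[of "lo f"] lh[OF f(1)] f hg by simp
        then show False using \<open>W = {}\<close> by simp
      next
        case False
        then show False using fg[of "lo e"] e_below_f[of "lo e"] lh[OF e] gat by simp
      qed
    qed
  qed
qed

lemma line_eqI:
  assumes "slope e = slope f" "ordinate e x = ordinate f x"
  shows "line_of e = line_of f"
  using assms by (auto simp: ordinate_def height_def prod_eq_iff)

text \<open>
  Each of the three kinds of charge hits a vertex at most once, because two segments charged to
  the same vertex in the same way have a common interior point: they either run along the same line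
  next to the vertex, or both pass through the same point below it.
\<close>
lemma crossing_free_card_le:
  assumes dr: "drawn_on V E" and cf: "crossing_free E"
  shows "card E \<le> 3 * card V"
proof -
  define A where "A = {e \<in> E. top_from_left E e}"
  define B where "B = {e \<in> E. top_into_right E e}"
  define C where "C = {e \<in> E. \<exists>w\<in>V. first_below E w e}"
  have finV: "finite V" and finE: "finite E" and lh: "\<And>f. f \<in> E \<Longrightarrow> lo f < hi f"
    and ends: "left_end ` E \<subseteq> V" "right_end ` E \<subseteq> V"
    using dr by (auto simp: drawn_on_def)
  have eqI: "e = f" if "e \<in> E" "f \<in> E" "lo e < x" "x < hi e" "lo f < x" "x < hi f" "ordinate e x = ordinate f x" for e f x
    using cf that unfolding crossing_free_def crosses_def by blast
  have "inj_on left_end A"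
  proof (rule inj_onI)
    fix e f assume ef: "e \<in> A" "f \<in> A" "left_end e = left_end f"
    then have "slope e = slope f" by (auto simp: A_def top_from_left_def intro!: antisym)
    moreover have l: "lo e = lo f" "ordinate e (lo e) = ordinate f (lo f)" using ef by (auto simp: left_end_def)
    ultimately have "line_of e = line_of f" using line_eqI[of e f "lo e"] by simp
    moreover have "lo e < min (hi e) (hi f)" using lh[of e] lh[of f] ef l by (simp add: A_def)
    then obtain x where "lo e < x" "x < min (hi e) (hi f)" using dense by blast
    ultimately show "e = f" using eqI[of e f x] ef l by (auto simp: A_def ordinate_def)
  qed
  then have A: "card A \<le> card V"
    using ends finV by (intro card_inj_on_le[of left_end]) (auto simp: A_def)
  have "inj_on right_end B"
  proof (rule inj_onI)
    fix e f assume ef: "e \<in> B" "f \<in> B" "right_end e = right_end f"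
    then have "slope e = slope f" by (auto simp: B_def top_into_right_def intro!: antisym)
    moreover have l: "hi e = hi f" "ordinate e (hi e) = ordinate f (hi f)" using ef by (auto simp: right_end_def)
    ultimately have "line_of e = line_of f" using line_eqI[of e f "hi e"] by simp
    moreover have "max (lo e) (lo f) < hi e" using lh[of e] lh[of f] ef l by (simp add: B_def)
    then obtain x where "max (lo e) (lo f) < x" "x < hi e" using dense by blast
    ultimately show "e = f" using eqI[of e f x] ef l by (auto simp: B_def ordinate_def)
  qed
  then have B: "card B \<le> card V"
    using ends finV by (intro card_inj_on_le[of right_end]) (auto simp: B_def)
  define above where "above e = (SOME w. w \<in> V \<and> first_below E w e)" for e
  have above: "above e \<in> V" "first_below E (above e) e" if "e \<in> C" for e
  proof -
    have "\<exists>w. w \<in> V \<and> first_below E w e" using that by (auto simp: C_def)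
    from someI_ex[OF this] show "above e \<in> V" "first_below E (above e) e"
      by (auto simp: above_def)
  qed
  have "inj_on above C"
  proof (rule inj_onI)
    fix e f assume ef: "e \<in> C" "f \<in> C" and eq: "above e = above f"
    show "e = f"
      using above(2)[OF ef(1)] above(2)[OF ef(2)] ef eq
      by (intro eqI[of e f "fst (above e)"]) (auto simp: C_def first_below_def intro!: antisym)
  qed
  then have C: "card C \<le> card V"
    using above finV by (intro card_inj_on_le[of above]) auto
  have "E \<subseteq> A \<union> B \<union> C" using charging[OF dr cf] by (auto simp: A_def B_def C_def)
  then have "card E \<le> card (A \<union> B \<union> C)" using finE by (intro card_mono) (auto simp: A_def B_def C_def)
  also have "\<dots> \<le> card A + card B + card C"
    by (meson add_le_mono card_Un_le le_refl order_trans)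
  finally show ?thesis using A B C by linarith
qed

section \<open>The crossing inequality\<close>

definition crossing_pairs :: "segment set \<Rightarrow> (segment \<times> segment) set" where
  "crossing_pairs E = {(e, f). e \<in> E \<and> f \<in> E \<and> e \<noteq> f \<and> crosses e f}"

lemma finite_crossing_pairs: "finite E \<Longrightarrow> finite (crossing_pairs E)"
  by (rule finite_subset[of _ "E \<times> E"]) (auto simp: crossing_pairs_def)

text \<open>
  Deleting the first segment of every crossing pair leaves a crossing-free drawing.
\<close>
lemma card_le_crossing_pairs:
  assumes dr: "drawn_on V E"
  shows "card E \<le> 3 * card V + card (crossing_pairs E)"
proof -
  define B where "B = fst ` crossing_pairs E"
  have finE: "finite E" using dr by (simp add: drawn_on_def)
  have B: "card B \<le> card (crossing_pairs E)"
    unfolding B_def by (intro card_image_le finite_crossing_pairs finE)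
  have "crossing_free (E - B)"
    unfolding crossing_free_def
  proof (intro ballI impI notI)
    fix e f assume "e \<in> E - B" "f \<in> E - B" "e \<noteq> f" "crosses e f"
    then have "(e, f) \<in> crossing_pairs E" by (simp add: crossing_pairs_def)
    then have "e \<in> B" unfolding B_def by (metis fst_conv imageI)
    then show False using \<open>e \<in> E - B\<close> by simp
  qed
  moreover have "drawn_on V (E - B)" using dr by (auto simp: drawn_on_def)
  ultimately have "card (E - B) \<le> 3 * card V" by (rule crossing_free_card_le[rotated])
  moreover have "card E - card B \<le> card (E - B)"
    unfolding B_def by (intro diff_card_le_card_Diff finite_imageI finite_crossing_pairs finE)
  ultimately show ?thesis using B by linarith
qed

section \<open>Averaging over random subsets\<close>

text \<open>
  The probability of obtaining \<open>S\<close> when every element of \<open>V\<close> is chosen independently with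
  probability \<open>p\<close>.
\<close>
definition subset_weight :: "real \<Rightarrow> 'a set \<Rightarrow> 'a set \<Rightarrow> real" where
  "subset_weight p V S = p ^ card S * (1 - p) ^ card (V - S)"

text \<open>
  The probability that the random set contains \<open>A\<close>: the sum over all subsets is the expansion of
  a product over \<open>V\<close>, in which the factor of \<open>v\<close> is \<open>p\<close> if \<open>v\<close> is required, and \<open>p + (1 - p)\<close> if not.
\<close>
lemma sum_subset_weight_superset:
  assumes "finite V" "A \<subseteq> V"
  shows "(\<Sum>S\<in>Pow V. subset_weight p V S * of_bool (A \<subseteq> S)) = p ^ card A"
proof -
  have "(\<Sum>S\<in>Pow V. subset_weight p V S * of_bool (A \<subseteq> S)) =
        (\<Sum>S\<in>Pow V. (\<Prod>v\<in>S. p) * (\<Prod>v\<in>V - S. (1 - p) * of_bool (v \<notin> A)))"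
  proof (rule sum.cong[OF refl])
    fix S assume S: "S \<in> Pow V"
    have "(\<Prod>v\<in>V - S. of_bool (v \<notin> A)) = (of_bool (A \<subseteq> S) :: real)"
    proof (cases "A \<subseteq> S")
      case True
      then show ?thesis by (auto intro!: prod.neutral)
    next
      case False
      then show ?thesis using assms S by (auto intro!: prod_zero)
    qed
    then show "subset_weight p V S * of_bool (A \<subseteq> S) =
        (\<Prod>v\<in>S. p) * (\<Prod>v\<in>V - S. (1 - p) * of_bool (v \<notin> A))"
      by (simp add: subset_weight_def prod.distrib)
  qed
  also have "\<dots> = (\<Prod>v\<in>V. p + (1 - p) * of_bool (v \<notin> A))"
    using prod_add[OF assms(1), of "\<lambda>_. p" "\<lambda>v. (1 - p) * of_bool (v \<notin> A)"] by simp
  also have "\<dots> = (\<Prod>v\<in>V. if v \<in> A then p else 1)"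
    by (rule prod.cong) auto
  also have "\<dots> = p ^ card A"
    using assms by (simp add: prod.If_cases Int_absorb1)
  finally show ?thesis .
qed

lemma expected_card_captured:
  assumes "finite V" "finite I" "\<And>i. i \<in> I \<Longrightarrow> A i \<subseteq> V"
  shows "(\<Sum>S\<in>Pow V. subset_weight p V S * real (card {i \<in> I. A i \<subseteq> S})) = (\<Sum>i\<in>I. p ^ card (A i))"
proof -
  have "real (card {i \<in> I. A i \<subseteq> S}) = (\<Sum>i\<in>I. of_bool (A i \<subseteq> S))" for S
    using assms(2) by (simp add: of_bool_def sum.If_cases Int_def)
  then have "(\<Sum>S\<in>Pow V. subset_weight p V S * real (card {i \<in> I. A i \<subseteq> S}))
     = (\<Sum>S\<in>Pow V. \<Sum>i\<in>I. subset_weight p V S * of_bool (A i \<subseteq> S))"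
    by (simp add: sum_distrib_left)
  also have "\<dots> = (\<Sum>i\<in>I. \<Sum>S\<in>Pow V. subset_weight p V S * of_bool (A i \<subseteq> S))"
    by (rule sum.swap)
  also have "\<dots> = (\<Sum>i\<in>I. p ^ card (A i))"
    using assms by (intro sum.cong refl sum_subset_weight_superset)
  finally show ?thesis .
qed

text \<open>
  If an inequality between vertices, edges and crossings holds for the part captured by every
  subset, then it holds in expectation. Vertices, edges and crossings are captured
  with probability \<open>p\<close>, \<open>p\<^sup>2\<close> and \<open>p\<^sup>4\<close>.
\<close>
lemma averaged_inequality:
  fixes p :: real
  assumes fin: "finite V" "finite E" "finite X"
    and E: "\<And>e. e \<in> E \<Longrightarrow> A e \<subseteq> V \<and> card (A e) = 2"
    and X: "\<And>x. x \<in> X \<Longrightarrow> B x \<subseteq> V \<and> card (B x) = 4"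
    and le: "\<And>S. S \<subseteq> V \<Longrightarrow> card {e \<in> E. A e \<subseteq> S} \<le> 3 * card S + card {x \<in> X. B x \<subseteq> S}"
    and p: "0 \<le> p" "p \<le> 1"
  shows "p ^ 2 * card E \<le> 3 * p * card V + p ^ 4 * card X"
proof -
  let ?w = "subset_weight p V"
  have "p ^ 2 * card E = (\<Sum>S\<in>Pow V. ?w S * real (card {e \<in> E. A e \<subseteq> S}))"
    using fin E by (subst expected_card_captured) auto
  also have "\<dots> \<le> (\<Sum>S\<in>Pow V. ?w S * (3 * real (card {v \<in> V. {v} \<subseteq> S}) + real (card {x \<in> X. B x \<subseteq> S})))"
  proof (intro sum_mono mult_left_mono)
    fix S assume S: "S \<in> Pow V"
    have "{v \<in> V. {v} \<subseteq> S} = S" using S by auto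
    moreover have "real (card {e \<in> E. A e \<subseteq> S}) \<le> real (3 * card S + card {x \<in> X. B x \<subseteq> S})"
      using le[of S] S by (simp only: of_nat_le_iff) auto
    ultimately show "real (card {e \<in> E. A e \<subseteq> S})
        \<le> 3 * real (card {v \<in> V. {v} \<subseteq> S}) + real (card {x \<in> X. B x \<subseteq> S})" by simp
    show "0 \<le> ?w S" using p by (simp add: subset_weight_def)
  qed
  also have "\<dots> = 3 * (\<Sum>S\<in>Pow V. ?w S * real (card {v \<in> V. {v} \<subseteq> S}))
      + (\<Sum>S\<in>Pow V. ?w S * real (card {x \<in> X. B x \<subseteq> S}))"
    by (simp add: algebra_simps sum.distrib sum_distrib_left)
  also have "\<dots> = 3 * p * card V + p ^ 4 * card X"
    using fin X by (subst (1 2) expected_card_captured) auto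
  finally show ?thesis .
qed

text \<open>
  After division by \<open>p\<close>, the choice \<open>p = 4 v / e\<close> makes the edge term \<open>p e = 4 v\<close> exceed the vertex term \<open>3 v\<close>
  by \<open>v\<close>, which the crossings have to pay for; the hypothesis \<open>4 v \<le> e\<close> says that \<open>p\<close> is a probability.
\<close>
lemma amplification:
  fixes e v x :: real
  assumes "0 < v" "4 * v \<le> e"
    and le: "\<And>p. 0 \<le> p \<Longrightarrow> p \<le> 1 \<Longrightarrow> p ^ 2 * e \<le> 3 * p * v + p ^ 4 * x"
  shows "e ^ 3 \<le> 64 * v ^ 2 * x"
proof -
  define p where "p = 4 * v / e"
  have e: "0 < e" using assms by linarith
  have p: "0 < p" "p \<le> 1" "p * e = 4 * v" using assms e by (auto simp: p_def)
  have "p * (p * e) \<le> p * (3 * v + p ^ 3 * x)"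
    using le[of p] p(1,2) by (simp add: power2_eq_square power4_eq_xxxx power3_eq_cube algebra_simps)
  then have "p * e \<le> 3 * v + p ^ 3 * x" using p by simp
  then have "v \<le> p ^ 3 * x" using p by linarith
  then have "v * e ^ 3 \<le> p ^ 3 * x * e ^ 3" using e by simp
  also have "\<dots> = (p * e) ^ 3 * x" by (simp add: power_mult_distrib)
  also have "\<dots> = v * (64 * v ^ 2 * x)" unfolding p(3) by (simp add: power_mult_distrib power2_eq_square power3_eq_cube)
  finally show ?thesis using assms(1) by simp
qed

section \<open>Incidences with non-vertical lines\<close>

text \<open>
  The segments between consecutive points of \<open>P\<close> on the lines of \<open>K\<close>.
\<close>
definition gaps :: "(real \<times> real) set \<Rightarrow> (real \<times> real) set \<Rightarrow> segment set" where
  "gaps P K = {e. line_of e \<in> K \<and> lo e < hi e \<and> left_end e \<in> P \<and> right_end e \<in> P \<and>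
     (\<forall>x. lo e < x \<and> x < hi e \<longrightarrow> (x, ordinate e x) \<notin> P)}"

definition graph_incidences :: "(real \<times> real) set \<Rightarrow> (real \<times> real) set \<Rightarrow> ((real \<times> real) \<times> (real \<times> real)) set" where
  "graph_incidences P K = {(p, k). p \<in> P \<and> k \<in> K \<and> snd p = height k (fst p)}"

lemma finite_gaps: "finite P \<Longrightarrow> finite K \<Longrightarrow> finite (gaps P K)"
proof (rule finite_subset[of _ "K \<times> fst ` P \<times> fst ` P"])
  show "gaps P K \<subseteq> K \<times> fst ` P \<times> fst ` P"
  proof
    fix e assume "e \<in> gaps P K"
    then have "line_of e \<in> K" "fst (left_end e) \<in> fst ` P" "fst (right_end e) \<in> fst ` P"
      by (simp_all add: gaps_def)
    then show "e \<in> K \<times> fst ` P \<times> fst ` P"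
      by (cases e) (simp add: left_end_def right_end_def)
  qed
qed simp

text \<open>
  An incidence of \<open>p\<close> with a line is the left end of a gap, unless \<open>p\<close> is the last point on that line.
\<close>
lemma card_graph_incidences_le:
  assumes "finite P" "finite K"
  shows "card (graph_incidences P K) \<le> card (gaps P K) + card K"
proof -
  let ?I = "graph_incidences P K"
  let ?start = "\<lambda>e. (left_end e, line_of e)"
  define R where "R = {z \<in> ?I. \<forall>q\<in>P. snd q = height (snd z) (fst q) \<longrightarrow> fst q \<le> fst (fst z)}"
  have "inj_on snd R"
  proof (rule inj_onI)
    fix z z' assume z: "z \<in> R" "z' \<in> R" and eq: "snd z = snd z'"
    have on: "fst z \<in> P" "snd (fst z) = height (snd z) (fst (fst z))"
      "fst z' \<in> P" "snd (fst z') = height (snd z') (fst (fst z'))"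
      using z by (auto simp: R_def graph_incidences_def)
    have "fst (fst z) \<le> fst (fst z')" "fst (fst z') \<le> fst (fst z)"
      using z on eq unfolding R_def by auto
    then show "z = z'" using on eq by (simp add: prod_eq_iff)
  qed
  then have R: "card R \<le> card K"
    using assms by (intro card_inj_on_le[of snd]) (auto simp: R_def graph_incidences_def)
  have sub: "?I \<subseteq> ?start ` gaps P K \<union> R"
  proof safe
    fix a b c d assume I: "((a, b), c, d) \<in> ?I" and nR: "((a, b), c, d) \<notin> R"
    define k where "k = (c, d)"
    \<comment> \<open>The points further right on the line; the leftmost of them closes the gap.\<close>
    define Q where "Q = {q \<in> P. snd q = height k (fst q) \<and> a < fst q}"
    have "finite Q" "Q \<noteq> {}" using assms I nR by (auto simp: Q_def R_def k_def not_le)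
    then obtain q where q: "q \<in> Q" "\<And>v. v \<in> Q \<Longrightarrow> fst q \<le> fst v"
      using finite_minimizer[of Q fst] by blast
    have gap: "(k, a, fst q) \<in> gaps P K"
    proof -
      have "(x, height k x) \<notin> P" if "a < x" "x < fst q" for x
        using q(2)[of "(x, height k x)"] that by (auto simp: Q_def)
      moreover have "(a, height k a) \<in> P" "k \<in> K" using I by (auto simp: graph_incidences_def k_def)
      moreover have "a < fst q" "(fst q, height k (fst q)) \<in> P"
        using q(1) by (auto simp: Q_def) (metis prod.collapse)
      ultimately show ?thesis by (auto simp: gaps_def left_end_def right_end_def ordinate_def)
    qed
    have "((a, b), c, d) = ?start (k, a, fst q)"
      using I by (auto simp: left_end_def ordinate_def graph_incidences_def k_def)
    then show "((a, b), c, d) \<in> ?start ` gaps P K" using gap by blast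
  qed
  have fg: "finite (gaps P K)" using assms by (rule finite_gaps)
  have "finite R" using assms by (rule_tac finite_subset[of _ "P \<times> K"]) (auto simp: R_def graph_incidences_def)
  then have "card ?I \<le> card (?start ` gaps P K \<union> R)" using sub fg by (intro card_mono) auto
  also have "\<dots> \<le> card (gaps P K) + card K"
    using card_Un_le[of "?start ` gaps P K" R] card_image_le[OF fg, of ?start] R by linarith
  finally show ?thesis .
qed

lemma gaps_unique:
  assumes "e \<in> gaps P K" "f \<in> gaps P K" "line_of e = line_of f"
    and "lo e < x" "x < hi e" "lo f < x" "x < hi f"
  shows "e = f"
proof -
  have same: "ordinate e z = ordinate f z" for z using assms(3) by (simp add: ordinate_def)
  have ne: "(z, ordinate f z) \<notin> P" if "lo e < z \<and> z < hi e \<or> lo f < z \<and> z < hi f" for z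
    using assms(1,2) that same by (auto simp: gaps_def)
  have "(lo e, ordinate f (lo e)) \<in> P" "(lo f, ordinate f (lo f)) \<in> P" "(hi e, ordinate f (hi e)) \<in> P" "(hi f, ordinate f (hi f)) \<in> P"
    using assms(1,2) same by (auto simp: gaps_def left_end_def right_end_def)
  then have "lo e = lo f" "hi e = hi f"
    using ne[of "lo e"] ne[of "lo f"] ne[of "hi e"] ne[of "hi f"] assms(4-7) by linarith+
  then show ?thesis using assms(3) by (simp add: prod_eq_iff)
qed

lemma height_eq_unique:
  assumes "k \<noteq> k'" "height k x = height k' x" "height k y = height k' y"
  shows "x = y"
proof (rule ccontr)
  assume "x \<noteq> y"
  have "(fst k - fst k') * (x - y) = 0" using assms(2,3) by (simp add: height_def algebra_simps)
  then have "fst k = fst k'" using \<open>x \<noteq> y\<close> by simp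
  then show False using assms by (auto simp: height_def prod_eq_iff)
qed

lemma crossing_gaps:
  assumes "(e, f) \<in> crossing_pairs (gaps P K)"
  obtains x where "lo e < x" "x < hi e" "lo f < x" "x < hi f" "ordinate e x = ordinate f x"
    "line_of e \<noteq> line_of f" "e \<in> gaps P K" "f \<in> gaps P K"
proof -
  from assms obtain x where x: "lo e < x" "x < hi e" "lo f < x" "x < hi f" "ordinate e x = ordinate f x"
    and ef: "e \<in> gaps P K" "f \<in> gaps P K" "e \<noteq> f"
    by (auto simp: crossing_pairs_def crosses_def)
  have "line_of e \<noteq> line_of f" using gaps_unique[OF ef(1,2) _ x(1-4)] ef(3) by blast
  then show ?thesis using that x ef by blast
qed

text \<open>
  A crossing of two gaps is determined by their lines: these meet in one point only, and on each
  line only one gap has that point in its interior.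
\<close>
lemma card_crossing_gaps_le:
  assumes "finite K"
  shows "card (crossing_pairs (gaps P K)) \<le> card K ^ 2"
proof -
  let ?h = "\<lambda>(e, f). (line_of e, line_of f)"
  have "inj_on ?h (crossing_pairs (gaps P K))"
  proof (rule inj_onI)
    fix u u' assume u: "u \<in> crossing_pairs (gaps P K)" and u': "u' \<in> crossing_pairs (gaps P K)"
      and eq: "?h u = ?h u'"
    obtain e f e' f' where uu: "u = (e, f)" "u' = (e', f')" by (metis surj_pair)
    from u uu obtain x where x: "lo e < x" "x < hi e" "lo f < x" "x < hi f" "ordinate e x = ordinate f x"
      "line_of e \<noteq> line_of f" "e \<in> gaps P K" "f \<in> gaps P K" using crossing_gaps by blast
    from u' uu obtain y where y: "lo e' < y" "y < hi e'" "lo f' < y" "y < hi f'" "ordinate e' y = ordinate f' y"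
      "e' \<in> gaps P K" "f' \<in> gaps P K" using crossing_gaps by blast
    have l: "line_of e = line_of e'" "line_of f = line_of f'" using eq uu by auto
    have "x = y" using height_eq_unique[OF x(6), of x y] x(5) y(5) l by (simp add: ordinate_def)
    then have "e = e'" "f = f'" using gaps_unique[of e P K e' x] gaps_unique[of f P K f' x] x y l by auto
    then show "u = u'" using uu by simp
  qed
  then have "card (crossing_pairs (gaps P K)) \<le> card (K \<times> K)"
    using assms by (intro card_inj_on_le[of ?h]) (auto simp: crossing_pairs_def gaps_def)
  then show ?thesis by (simp add: card_cartesian_product power2_eq_square)
qed

definition ends :: "segment \<Rightarrow> (real \<times> real) set" where
  "ends e = {left_end e, right_end e}"

text \<open>
  A shared end point would be a second common point of the two lines, next to the crossing,
  which is interior to both gaps.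
\<close>
lemma card_ends_crossing_gaps:
  assumes "(e, f) \<in> crossing_pairs (gaps P K)"
  shows "card (ends e \<union> ends f) = 4"
proof -
  from assms obtain x where x: "lo e < x" "x < hi e" "lo f < x" "x < hi f" "ordinate e x = ordinate f x"
    "line_of e \<noteq> line_of f" using crossing_gaps by blast
  have ne: "ordinate e z \<noteq> ordinate f z" if "z \<noteq> x" for z
    using height_eq_unique[OF x(6), of x z] x(5) that by (auto simp: ordinate_def)
  have "distinct [left_end e, right_end e, left_end f, right_end f]"
    using x ne[of "lo e"] ne[of "hi e"] by (auto simp: left_end_def right_end_def)
  from distinct_card[OF this] show ?thesis by (simp add: ends_def insert_commute Un_commute)
qed

text \<open>
  The crossing inequality for the graph of gaps. The sub-drawing on \<open>S \<subseteq> P\<close> consists of those gaps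
  of \<open>P\<close> that have both ends in \<open>S\<close>, not of the gaps of \<open>S\<close>, so its crossings are exactly the
  crossings of \<open>P\<close> with all four ends in \<open>S\<close>.
\<close>
lemma card_gaps_cubed_le:
  assumes fin: "finite P" "finite K" and "P \<noteq> {}" and big: "4 * card P \<le> card (gaps P K)"
  shows "real (card (gaps P K)) ^ 3 \<le> 64 * real (card P) ^ 2 * real (card K) ^ 2"
proof -
  let ?E = "gaps P K"
  let ?X = "crossing_pairs ?E"
  let ?B = "\<lambda>(e, f). ends e \<union> ends f"
  have finE: "finite ?E" using fin by (rule finite_gaps)
  have "p ^ 2 * card ?E \<le> 3 * p * card P + p ^ 4 * card ?X" if p: "0 \<le> p" "p \<le> 1" for p :: real
  proof (rule averaged_inequality[of P ?E ?X ends ?B p, OF fin(1) finE finite_crossing_pairs[OF finE]])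
    show "ends e \<subseteq> P \<and> card (ends e) = 2" if "e \<in> ?E" for e
      using that by (auto simp: ends_def gaps_def left_end_def right_end_def)
    show "?B z \<subseteq> P \<and> card (?B z) = 4" if "z \<in> ?X" for z
      using that card_ends_crossing_gaps[of "fst z" "snd z" P K]
      by (auto simp: crossing_pairs_def ends_def gaps_def)
    fix S assume S: "S \<subseteq> P"
    let ?F = "{e \<in> ?E. ends e \<subseteq> S}"
    have "drawn_on S ?F"
      unfolding drawn_on_def
    proof (intro conjI ballI)
      show "finite S" "finite ?F" using finite_subset[OF S fin(1)] finE by auto
      fix e assume e: "e \<in> ?F"
      then show "lo e < hi e" "left_end e \<in> S" "right_end e \<in> S"
        by (auto simp: gaps_def ends_def)
      fix v assume "v \<in> S"
      then show "lo e < fst v \<and> fst v < hi e \<longrightarrow> snd v \<noteq> ordinate e (fst v)"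
        using e S by (cases v) (auto simp: gaps_def)
    qed
    from card_le_crossing_pairs[OF this]
    have "card ?F \<le> 3 * card S + card (crossing_pairs ?F)" .
    moreover have "crossing_pairs ?F = {z \<in> ?X. ?B z \<subseteq> S}"
      by (auto simp: crossing_pairs_def)
    ultimately show "card ?F \<le> 3 * card S + card {z \<in> ?X. ?B z \<subseteq> S}" by simp
  qed (use p in auto)
  then have "real (card ?E) ^ 3 \<le> 64 * real (card P) ^ 2 * real (card ?X)"
    using assms by (intro amplification) (auto simp: card_gt_0_iff)
  also have "\<dots> \<le> 64 * real (card P) ^ 2 * real (card K ^ 2)"
    by (intro mult_left_mono of_nat_mono card_crossing_gaps_le fin(2)) simp
  finally show ?thesis by simp
qed

lemma powr_two_thirds_cubed:
  fixes t :: real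
  assumes "0 \<le> t"
  shows "(t powr (2/3)) ^ 3 = t ^ 2"
proof (cases "t = 0")
  case False
  have "(t powr (2/3)) ^ 3 = t powr (real 3 * (2/3))"
    using False by (intro powr_power)
  also have "\<dots> = t powr real 2" by simp
  also have "\<dots> = t ^ 2" using False assms by (intro powr_realpow) simp
  finally show ?thesis .
qed simp

lemma cube_le_imp_le_powr:
  fixes e m n :: real
  assumes "0 \<le> e" "0 \<le> m" "0 \<le> n" "e ^ 3 \<le> 64 * m ^ 2 * n ^ 2"
  shows "e \<le> 4 * (m powr (2/3) * n powr (2/3))"
proof -
  have "e ^ 3 \<le> (4 * (m powr (2/3) * n powr (2/3))) ^ 3"
    using assms unfolding power_mult_distrib powr_two_thirds_cubed[OF assms(2)]
      powr_two_thirds_cubed[OF assms(3)] by simp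
  then show ?thesis by (subst (asm) power_mono_iff) (use assms in auto)
qed

lemma graph_incidences_bound:
  assumes "finite P" "finite K" "P \<noteq> {}"
  shows "real (card (graph_incidences P K))
    \<le> 4 * (real (card P) powr (2/3) * real (card K) powr (2/3)) + 4 * card P + card K"
proof -
  have "real (card (gaps P K)) \<le> 4 * (real (card P) powr (2/3) * real (card K) powr (2/3)) + 4 * card P"
  proof (cases "4 * card P \<le> card (gaps P K)")
    case True
    from cube_le_imp_le_powr[OF _ _ _ card_gaps_cubed_le[OF assms True]]
    show ?thesis by simp
  next
    case False
    moreover have "0 \<le> real (card P) powr (2/3) * real (card K) powr (2/3)" by simp
    ultimately show ?thesis by linarith
  qed
  then show ?thesis using card_graph_incidences_le[OF assms(1,2)] by linarith
qed

section \<open>Lines in the Euclidean plane\<close>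

definition graph_line :: "real \<times> real \<Rightarrow> (real ^ 2) set" where
  "graph_line k = {p. p $ 2 = height k (p $ 1)}"

definition vertical_line :: "real \<Rightarrow> (real ^ 2) set" where
  "vertical_line c = {p. p $ 1 = c}"

lemma is_line_cases:
  assumes "is_line l"
  obtains c where "l = vertical_line c" | k where "l = graph_line k"
proof -
  obtain B where B: "\<not> affine_dependent B" "affine hull B = affine hull l"
    using affine_basis_exists[of l] by blast
  have hull: "affine hull l = l" using assms by (simp add: is_line_def hull_same)
  have "aff_dim l = int (card B) - 1" using aff_dim_unique[of B l] B by simp
  then have "card B = 2" using assms by (simp add: is_line_def)
  then obtain u v where uv: "B = {u, v}" "u \<noteq> v" by (auto simp: card_2_iff)
  have l: "l = {s *\<^sub>R u + t *\<^sub>R v |s t. s + t = 1}"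
    using B(2) uv(1) hull affine_hull_2[of u v] by simp
  have mem: "p \<in> l \<longleftrightarrow> (\<exists>t. p $ 1 = u $ 1 + t * (v $ 1 - u $ 1) \<and> p $ 2 = u $ 2 + t * (v $ 2 - u $ 2))" for p
  proof
    assume "p \<in> l"
    then obtain s t where st: "p = s *\<^sub>R u + t *\<^sub>R v" "s + t = 1" using l by blast
    then have "p = (1 - t) *\<^sub>R u + t *\<^sub>R v" by (metis add_diff_cancel_right')
    then have "p $ 1 = (1 - t) * u $ 1 + t * v $ 1" "p $ 2 = (1 - t) * u $ 2 + t * v $ 2" by simp_all
    then show "\<exists>t. p $ 1 = u $ 1 + t * (v $ 1 - u $ 1) \<and> p $ 2 = u $ 2 + t * (v $ 2 - u $ 2)"
      by (intro exI[of _ t]) (simp add: algebra_simps)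
  next
    assume "\<exists>t. p $ 1 = u $ 1 + t * (v $ 1 - u $ 1) \<and> p $ 2 = u $ 2 + t * (v $ 2 - u $ 2)"
    then obtain t where "p $ 1 = u $ 1 + t * (v $ 1 - u $ 1)" "p $ 2 = u $ 2 + t * (v $ 2 - u $ 2)" by blast
    then have "p = (1 - t) *\<^sub>R u + t *\<^sub>R v" by (simp add: vec_eq_iff forall_2 algebra_simps)
    then show "p \<in> l" using l by force
  qed
  show ?thesis
  proof (cases "u $ 1 = v $ 1")
    case True
    then have d: "v $ 2 - u $ 2 \<noteq> 0" using uv(2) by (auto simp: vec_eq_iff forall_2)
    have "p \<in> l \<longleftrightarrow> p $ 1 = u $ 1" for p
      using True d mem[of p] by (auto intro!: exI[of _ "(p $ 2 - u $ 2) / (v $ 2 - u $ 2)"])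
    then show ?thesis using that(1)[of "u $ 1"] by (auto simp: vertical_line_def)
  next
    case False
    define a where "a = (v $ 2 - u $ 2) / (v $ 1 - u $ 1)"
    have a: "a * (v $ 1 - u $ 1) = v $ 2 - u $ 2" using False by (simp add: a_def)
    have "p \<in> l \<longleftrightarrow> p $ 2 = a * p $ 1 + (u $ 2 - a * u $ 1)" for p
    proof
      assume "p \<in> l"
      then obtain t where t: "p $ 1 = u $ 1 + t * (v $ 1 - u $ 1)" "p $ 2 = u $ 2 + t * (v $ 2 - u $ 2)"
        using mem by blast
      have "t * (v $ 2 - u $ 2) = a * (p $ 1 - u $ 1)" unfolding a[symmetric] t(1) by simp
      then show "p $ 2 = a * p $ 1 + (u $ 2 - a * u $ 1)" using t(2) by (simp add: algebra_simps)
    next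
      assume p: "p $ 2 = a * p $ 1 + (u $ 2 - a * u $ 1)"
      define t where "t = (p $ 1 - u $ 1) / (v $ 1 - u $ 1)"
      have t: "t * (v $ 1 - u $ 1) = p $ 1 - u $ 1" using False by (simp add: t_def)
      have "t * (v $ 2 - u $ 2) = a * (p $ 1 - u $ 1)" using t by (metis a mult.left_commute)
      then show "p \<in> l" using mem[of p] t p by (intro iffD2[OF mem] exI[of _ t]) (simp add: algebra_simps)
    qed
    then have "l = graph_line (a, u $ 2 - a * u $ 1)"
      by (auto simp: graph_line_def height_def)
    then show ?thesis by (rule that(2))
  qed
qed

lemma inj_graph_line: "inj graph_line"
proof (rule injI)
  fix k k' assume eq: "graph_line k = graph_line k'"
  have h: "height k x = height k' x" for x
  proof -
    have "(\<chi> i. if i = 1 then x else height k x) \<in> graph_line k" by (simp add: graph_line_def)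
    then have "(\<chi> i. if i = 1 then x else height k x) \<in> graph_line k'" using eq by simp
    then show ?thesis by (simp add: graph_line_def)
  qed
  show "k = k'" using height_eq_unique[of k k' 0 1] h by fastforce
qed

text \<open>
  Each point lies on exactly one vertical line, so the incidences with vertical lines number at
  most \<open>card P\<close>; all others are incidences with graphs.
\<close>
lemma incidences_le_graph_incidences:
  assumes "finite P" "finite L" "\<forall>l\<in>L. is_line l"
  defines "coords \<equiv> \<lambda>p :: real ^ 2. (p $ 1, p $ 2)"
  shows "incidences P L \<le> card P + card (graph_incidences (coords ` P) (graph_line -` L))"
proof -
  let ?K = "graph_line -` L"
  let ?I = "graph_incidences (coords ` P) ?K"
  define T where "T = {(p, l). p \<in> P \<and> l \<in> L \<and> p \<in> l}"
  define Tv where "Tv = {(p, l). p \<in> P \<and> l = vertical_line (p $ 1)}"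
  have finK: "finite ?K" using assms inj_graph_line by (simp add: finite_vimageI)
  have "finite ?I"
    by (rule finite_subset[of _ "coords ` P \<times> ?K"]) (use assms finK in \<open>auto simp: graph_incidences_def\<close>)
  have Tv: "Tv = (\<lambda>p. (p, vertical_line (p $ 1))) ` P" by (auto simp: Tv_def)
  have sub: "\<exists>k. l = graph_line k" if "(p, l) \<in> T - Tv" for p l
  proof -
    have "is_line l" "p \<in> l" "p \<in> P" using that assms by (auto simp: T_def)
    from this(1) show ?thesis
    proof (cases rule: is_line_cases)
      case (1 c)
      then show ?thesis using \<open>p \<in> l\<close> \<open>p \<in> P\<close> that by (auto simp: Tv_def vertical_line_def)
    qed auto
  qed
  let ?h = "\<lambda>(p, l). (coords p, inv graph_line l)"
  have "inj_on ?h (T - Tv)"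
  proof (rule inj_onI)
    fix z z' assume z: "z \<in> T - Tv" "z' \<in> T - Tv" "?h z = ?h z'"
    obtain p l p' l' where zz: "z = (p, l)" "z' = (p', l')" by (metis surj_pair)
    obtain k k' where "l = graph_line k" "l' = graph_line k'" using sub z zz by metis
    then have "l = l'" using z zz by (simp add: inv_f_f[OF inj_graph_line])
    moreover have "p = p'" using z zz by (simp add: coords_def vec_eq_iff forall_2)
    ultimately show "z = z'" using zz by simp
  qed
  moreover have "?h ` (T - Tv) \<subseteq> ?I"
  proof (rule image_subsetI)
    fix z assume z: "z \<in> T - Tv"
    obtain p l where pl: "z = (p, l)" by (cases z)
    obtain k where k: "l = graph_line k" using sub z pl by blast
    have "coords p \<in> coords ` P" "k \<in> ?K" "p $ 2 = height k (p $ 1)"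
      using z pl k by (auto simp: T_def graph_line_def)
    then show "?h z \<in> ?I"
      by (simp add: pl k inv_f_f[OF inj_graph_line] graph_incidences_def coords_def)
  qed
  ultimately have "card (T - Tv) \<le> card ?I" using \<open>finite ?I\<close> by (intro card_inj_on_le[of ?h])
  moreover have "card Tv \<le> card P" unfolding Tv using assms(1) by (rule card_image_le)
  moreover have "card T - card Tv \<le> card (T - Tv)"
    unfolding Tv using assms(1) by (intro diff_card_le_card_Diff finite_imageI)
  ultimately show ?thesis by (simp add: incidences_def T_def)
qed

theorem theorem1p1:
  shows "\<exists>A::real. A > 0 \<and>
    (\<forall>(m::nat) (n::nat) (P :: (real ^ 2) set) (L :: (real ^ 2) set set).
       m > 0 \<longrightarrow> n > 0 \<longrightarrow>
       finite P \<longrightarrow> card P = m \<longrightarrow>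
       finite L \<longrightarrow> card L = n \<longrightarrow> (\<forall>l\<in>L. is_line l) \<longrightarrow>
       real (incidences P L)
         \<le> A * (real m powr (2/3) * real n powr (2/3) + real m + real n))"
proof (intro exI[of _ 5] conjI allI impI)
  fix m n :: nat and P :: "(real ^ 2) set" and L :: "(real ^ 2) set set"
  assume pos: "m > 0" "n > 0" and P: "finite P" "card P = m" and L: "finite L" "card L = n"
    and lines: "\<forall>l\<in>L. is_line l"
  define Q where "Q = (\<lambda>p :: real ^ 2. (p $ 1, p $ 2)) ` P"
  define K where "K = graph_line -` L"
  have "card Q = m"
    unfolding Q_def P(2)[symmetric] by (intro card_image inj_onI) (simp add: vec_eq_iff forall_2)
  moreover have "finite Q" using P by (simp add: Q_def)
  moreover have "finite K" using L inj_graph_line by (simp add: K_def finite_vimageI)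
  moreover have K: "card K \<le> n"
    using card_vimage_inj_on_le[OF inj_graph_line L(1)] L(2) by (simp add: K_def)
  moreover have "Q \<noteq> {}" using calculation(1) pos by auto
  ultimately have "real (card (graph_incidences Q K))
      \<le> 4 * (real m powr (2/3) * real (card K) powr (2/3)) + 4 * real m + real (card K)"
    using graph_incidences_bound[of Q K] by simp
  also have "\<dots> \<le> 4 * (real m powr (2/3) * real n powr (2/3)) + 4 * real m + real n"
    using K by (intro add_mono mult_left_mono powr_mono2) auto
  finally have "real (card (graph_incidences Q K))
      \<le> 4 * (real m powr (2/3) * real n powr (2/3)) + 4 * real m + real n" .
  moreover have "real (incidences P L) \<le> real m + real (card (graph_incidences Q K))"
    using incidences_le_graph_incidences[OF P(1) L(1) lines] P(2)
    by (simp add: Q_def K_def flip: of_nat_add)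
  moreover have "0 \<le> real m powr (2/3) * real n powr (2/3)" by simp
  ultimately show "real (incidences P L)
      \<le> 5 * (real m powr (2/3) * real n powr (2/3) + real m + real n)"
    unfolding distrib_left by linarith
qed simp

end
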